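(* As $n\to\infty$, $\operatorname{ldim}(P(1,2;n))=\log_2\log_2 n+O(\log_2\log_2\log_2 n)$.
   Context: $P(1,2;n)$ is the subposet of the Boolean lattice of subsets of $[n]=\{1,\dots,n\}$ (ordered by inclusion) induced by all subsets of size $1$ and all subsets of size $2$. Local dimension: a partial linear extension of a poset $\mathcal{P}=(P,\le)$ is a linear extension of an induced subposet. A local realizer is a nonempty set $\mathcal{L}$ of partial linear extensions such that (1) if $x<y$ in $\mathcal{P}$ then $x<y$ in some $L\in\mathcal{L}$, and (2) if $x,y$ are incomparable then $x<y$ in some $L\in\mathcal{L}$ and $y<x$ in some $L'\in\mathcal{L}$. $\operatorname{ldim}(\mathcal{P})$ is the least $k$ such that some local realizer has every element of $P$ in at most $k$ of its members. *)

theory Defs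
  imports Complex_Main "HOL-Library.Landau_Symbols"
begin

text \<open>
  A poset is given by its carrier \<open>P\<close> and its reflexive order relation
  \<open>r \<subseteq> P \<times> P\<close>. A partial linear extension is represented by its reflexive linear
  order \<open>L\<close> alone, since the set of elements it orders is recovered as \<open>Field L\<close>.
\<close>

definition partial_linear_extension :: "'a set \<Rightarrow> 'a rel \<Rightarrow> 'a rel \<Rightarrow> bool" where
  "partial_linear_extension P r L \<longleftrightarrow>
     Field L \<subseteq> P \<and> linear_order_on (Field L) L \<and> r \<inter> (Field L \<times> Field L) \<subseteq> L"

definition local_realizer :: "'a set \<Rightarrow> 'a rel \<Rightarrow> 'a rel set \<Rightarrow> bool" where
  "local_realizer P r \<L> \<longleftrightarrow>
     \<L> \<noteq> {} \<and>
     (\<forall>L\<in>\<L>. partial_linear_extension P r L) \<and>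
     (\<forall>x\<in>P. \<forall>y\<in>P. x \<noteq> y \<and> (x, y) \<in> r \<longrightarrow> (\<exists>L\<in>\<L>. (x, y) \<in> L)) \<and>
     (\<forall>x\<in>P. \<forall>y\<in>P. (x, y) \<notin> r \<and> (y, x) \<notin> r \<longrightarrow>
        (\<exists>L\<in>\<L>. (x, y) \<in> L) \<and> (\<exists>L'\<in>\<L>. (y, x) \<in> L'))"

text \<open>
  The finiteness conjunct is automatic for finite \<open>P\<close>; it is there because \<open>card\<close>
  of an infinite set is \<open>0\<close>. On posets without a local realizer of bounded
  multiplicity (necessarily infinite) the value of \<open>ldim\<close> is unspecified.
\<close>

definition ldim :: "'a set \<Rightarrow> 'a rel \<Rightarrow> nat" where
  "ldim P r = (LEAST k. \<exists>\<L>. local_realizer P r \<L> \<and>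
     (\<forall>x\<in>P. finite {L\<in>\<L>. x \<in> Field L} \<and> card {L\<in>\<L>. x \<in> Field L} \<le> k))"

definition subsets12 :: "nat \<Rightarrow> nat set set" where
  "subsets12 n = {A. A \<subseteq> {1..n} \<and> (card A = 1 \<or> card A = 2)}"

definition inclusion_on :: "'a set set \<Rightarrow> 'a set rel" where
  "inclusion_on S = {(A, B). A \<in> S \<and> B \<in> S \<and> A \<subseteq> B}"

definition ldim_P12 :: "nat \<Rightarrow> nat" where
  "ldim_P12 n = ldim (subsets12 n) (inclusion_on (subsets12 n))"

end

theory Submission
  imports Defs "HOL-Library.Nat_Bijection"
begin

text \<open>
  Lower bound. Suppose every element lies in at most \<open>k\<close> lists. There are a large set \<open>X\<close> of
  points and at most \<open>k\<close> lists containing all of \<open>X\<close> such that every other list contains only a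
  tiny part of \<open>X\<close>. A pair meets few points of \<open>X\<close> in the other lists, so averaging over subsets
  gives a set of more than \<open>2 ^ 2 ^ k\<close> points in which no pair meets a third point in another
  list. By Erdos-Szekeres it contains \<open>a, b, c\<close> with \<open>b\<close> between \<open>a\<close> and \<open>c\<close> in every common
  list, so \<open>{a, c}\<close> is never below \<open>{b}\<close>. Hence \<open>log 2 n = O(k * 2 ^ k)\<close>.

  Upper bound (Spencer). Order numbers by their binary expansions after flipping the bits in a
  set \<open>S\<close>. If the sets \<open>S\<close> realise all four sign patterns on any two bit positions, then any \<open>b\<close>
  is above any given \<open>a\<close> and \<open>c\<close> in one of these orders. By Sperner-type families, about
  \<open>log 2 (log 2 n)\<close> sets \<open>S\<close> suffice.
\<close>

section \<open>Betweenness in several linear orders\<close>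

text \<open>Label \<open>y\<close> with the size \<open>len y\<close> of a largest increasing set
  whose \<open>g\<close>-last element is \<open>y\<close>. A label above \<open>r\<close> yields the
  increasing set. Otherwise at most \<open>r\<close> labels occur and some label class has more than
  \<open>r\<close> points; on it \<open>f\<close> decreases, since \<open>f x < f y\<close> would
  let \<open>y\<close> extend a largest set ending at \<open>x\<close>.\<close>

lemma erdos_szekeres:
  fixes f g :: "'a \<Rightarrow> nat"
  assumes fin: "finite Y" and f: "inj_on f Y" and g: "inj_on g Y" and card: "r * r < card Y"
  shows "\<exists>Z\<subseteq>Y. r < card Z \<and>
    ((\<forall>x\<in>Z. \<forall>y\<in>Z. g x < g y \<longrightarrow> f x < f y) \<or> (\<forall>x\<in>Z. \<forall>y\<in>Z. g x < g y \<longrightarrow> f y < f x))"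
proof -
  define incr where "incr Z \<longleftrightarrow> (\<forall>x\<in>Z. \<forall>y\<in>Z. g x < g y \<longrightarrow> f x < f y)" for Z
  define chains where "chains y = {Z. Z \<subseteq> Y \<and> y \<in> Z \<and> incr Z \<and> (\<forall>x\<in>Z. g x \<le> g y)}" for y
  define len where "len y = Max (card ` chains y)" for y
  have fc: "finite (chains y)" for y
    using fin by (auto simp: chains_def intro: finite_subset[of _ "Pow Y"])
  have sing: "{y} \<in> chains y" if "y \<in> Y" for y
    using that by (auto simp: chains_def incr_def)
  have len_ge: "card Z \<le> len y" if "Z \<in> chains y" for Z y
    unfolding len_def using fc that by (intro Max_ge) auto
  have len_ex: "\<exists>Z\<in>chains y. card Z = len y" if "y \<in> Y" for y
  proof -
    have "len y \<in> card ` chains y"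
      unfolding len_def using fc sing[OF that] by (intro Max_in) auto
    then show ?thesis by force
  qed
  show ?thesis
  proof (cases "\<exists>y\<in>Y. r < len y")
    case True
    then obtain y Z where "Z \<in> chains y" "r < card Z"
      using len_ex by metis
    then show ?thesis
      unfolding chains_def incr_def by blast
  next
    case False
    have len_range: "len y \<in> {1..r}" if "y \<in> Y" for y
      using False that len_ge[OF sing[OF that]] by auto
    have "\<exists>l\<in>{1..r}. r < card {y\<in>Y. len y = l}"
    proof (rule ccontr)
      assume "\<not> ?thesis"
      then have small: "card {y\<in>Y. len y = l} \<le> r" if "l \<in> {1..r}" for l
        using that not_less by blast
      have "Y = (\<Union>l\<in>{1..r}. {y\<in>Y. len y = l})"
        using len_range by auto
      then have "card Y \<le> (\<Sum>l\<in>{1..r}. card {y\<in>Y. len y = l})"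
        by (metis card_UN_le finite_atLeastAtMost)
      also have "\<dots> \<le> (\<Sum>l\<in>{1..r}. r)"
        using small by (intro sum_mono) auto
      finally show False using card by simp
    qed
    then obtain l where l: "r < card {y\<in>Y. len y = l}" by blast
    have "f y < f x" if xy: "x \<in> Y" "y \<in> Y" "len x = len y" "g x < g y" for x y
    proof (rule ccontr)
      assume "\<not> f y < f x"
      moreover have "f x \<noteq> f y"
        using f xy by (metis inj_on_eq_iff less_irrefl)
      ultimately have fxy: "f x < f y" by simp
      obtain Z where Z: "Z \<in> chains x" "card Z = len x"
        using len_ex xy by blast
      \<comment> \<open>As the \<open>g\<close>-maximum of the increasing set \<open>Z\<close>, the
        point \<open>x\<close> is also its \<open>f\<close>-maximum.\<close>
      have fx: "f z \<le> f x" if "z \<in> Z" for z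
        using that Z g xy(1) unfolding chains_def incr_def
        by (cases "g z = g x") (auto simp: inj_on_def subset_iff order_le_less)
      have gx: "g z \<le> g x" if "z \<in> Z" for z
        using that Z(1) by (auto simp: chains_def)
      have "incr (insert y Z)"
        unfolding incr_def
      proof (intro ballI impI)
        fix u v assume uv: "u \<in> insert y Z" "v \<in> insert y Z" "g u < g v"
        then have "u \<in> Z" using gx xy(4) by fastforce
        then show "f u < f v"
          using uv Z(1) fx[of u] fxy by (auto simp: chains_def incr_def)
      qed
      then have "insert y Z \<in> chains y"
        using Z(1) xy gx by (force simp: chains_def)
      moreover have "y \<notin> Z" "finite Z"
        using Z xy fin unfolding chains_def by (auto intro: finite_subset)
      ultimately show False
        using len_ge[of "insert y Z" y] Z xy by simp
    qed
    then show ?thesis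
      using l by (intro exI[of _ "{y\<in>Y. len y = l}"]) auto
  qed
qed

lemma three_elements_increasing:
  fixes g :: "'a \<Rightarrow> nat"
  assumes "2 < card Y" "inj_on g Y"
  shows "\<exists>x\<in>Y. \<exists>y\<in>Y. \<exists>z\<in>Y. g x < g y \<and> g y < g z"
proof -
  obtain A where "A \<subseteq> Y" "card A = 3"
    using assms(1) by (metis Suc_leI eval_nat_numeral(3) obtain_subset_with_card_n)
  then obtain x y z where "{x, y, z} \<subseteq> Y" "x \<noteq> y" "y \<noteq> z" "x \<noteq> z"
    by (auto simp: card_3_iff)
  moreover from this have "g x \<noteq> g y" "g y \<noteq> g z" "g x \<noteq> g z"
    using assms(2) by (auto simp: inj_on_def)
  ultimately show ?thesis
    by (metis insert_subset linorder_neqE_nat)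
qed

text \<open>Each order costs a square root, as \<open>2 ^ 2 ^ (t + 1)\<close> is the square of
  \<open>2 ^ 2 ^ t\<close>: Erdos-Szekeres leaves more than \<open>2 ^ 2 ^ card T\<close> points on
  which \<open>f i\<close> is monotone or antitone in \<open>g\<close>. When no order is left, more
  than two points remain.\<close>

lemma between_in_all_orders:
  fixes f :: "'i \<Rightarrow> 'a \<Rightarrow> nat" and g :: "'a \<Rightarrow> nat"
  assumes "finite T" "finite Y" "inj_on g Y" "\<And>i. i \<in> T \<Longrightarrow> inj_on (f i) Y" "2 ^ 2 ^ card T < card Y"
  shows "\<exists>x\<in>Y. \<exists>y\<in>Y. \<exists>z\<in>Y. g x < g y \<and> g y < g z \<and>
    (\<forall>i\<in>T. f i x < f i y \<and> f i y < f i z \<or> f i z < f i y \<and> f i y < f i x)"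
  using assms
proof (induction T arbitrary: Y rule: finite_induct)
  case empty
  then show ?case using three_elements_increasing[of Y g] by simp
next
  case (insert i T)
  have "(2::nat) ^ 2 ^ card T * 2 ^ 2 ^ card T < card Y"
    using insert.prems(4) insert.hyps by (simp flip: power_add mult_2)
  then obtain Z where Z: "Z \<subseteq> Y" "2 ^ 2 ^ card T < card Z" and
    mono: "(\<forall>x\<in>Z. \<forall>y\<in>Z. g x < g y \<longrightarrow> f i x < f i y) \<or> (\<forall>x\<in>Z. \<forall>y\<in>Z. g x < g y \<longrightarrow> f i y < f i x)"
    using erdos_szekeres[of Y "f i" g "2 ^ 2 ^ card T"] insert.prems by blast
  have "finite Z" "inj_on g Z" "\<And>j. j \<in> T \<Longrightarrow> inj_on (f j) Z"
    using Z insert.prems by (auto intro: finite_subset inj_on_subset)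
  from insert.IH[OF this Z(2)] obtain x y z where
    "x \<in> Z" "y \<in> Z" "z \<in> Z" "g x < g y" "g y < g z"
    "\<forall>j\<in>T. f j x < f j y \<and> f j y < f j z \<or> f j z < f j y \<and> f j y < f j x"
    by blast
  with mono Z(1) show ?case
    by (intro bexI[of _ x] bexI[of _ y] bexI[of _ z]) auto
qed

section \<open>Free sets of bounded set mappings\<close>

lemma card_supersets:
  assumes "finite X" "A \<subseteq> X" "card A \<le> m"
  shows "card {Y. A \<subseteq> Y \<and> Y \<subseteq> X \<and> card Y = m} = (card X - card A) choose (m - card A)"
proof -
  have fin: "finite Y" if "Y \<subseteq> X" for Y
    using that assms(1) finite_subset by blast
  have "bij_betw (\<lambda>Z. Z \<union> A) {Z. Z \<subseteq> X - A \<and> card Z = m - card A}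
          {Y. A \<subseteq> Y \<and> Y \<subseteq> X \<and> card Y = m}"
  proof (rule bij_betw_byWitness[where f' = "\<lambda>Y. Y - A"])
    show "(\<lambda>Z. Z \<union> A) ` {Z. Z \<subseteq> X - A \<and> card Z = m - card A} \<subseteq> {Y. A \<subseteq> Y \<and> Y \<subseteq> X \<and> card Y = m}"
    proof safe
      fix Z assume Z: "Z \<subseteq> X - A" "card Z = m - card A"
      have "card (Z \<union> A) = card Z + card A"
        using Z assms(2) by (intro card_Un_disjoint fin) auto
      with Z assms(3) show "card (Z \<union> A) = m" by simp
    qed (use assms in auto)
  qed (use assms fin in \<open>auto simp: card_Diff_subset\<close>)
  then have "card {Y. A \<subseteq> Y \<and> Y \<subseteq> X \<and> card Y = m} = card {Z. Z \<subseteq> X - A \<and> card Z = m - card A}"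
    by (simp add: bij_betw_same_card)
  also have "\<dots> = (card X - card A) choose (m - card A)"
    using assms by (simp add: n_subsets card_Diff_subset fin)
  finally show ?thesis .
qed

text \<open>There are at most \<open>N ^ 3 / (8 * m ^ 3)\<close> bad triples of distinct points,
  each lying in \<open>(N - 3) choose (m - 3)\<close> of the \<open>m\<close>-subsets. If every
  \<open>m\<close>-subset contained one, comparison with \<open>N choose m\<close> would give
  \<open>8 * ((N - 1) * (N - 2)) \<le> N * N\<close>, which fails for
  \<open>N \<ge> 3\<close>.\<close>

lemma free_set_exists:
  fixes D :: "'a \<Rightarrow> 'a \<Rightarrow> 'a set"
  assumes fin: "finite X" and m: "3 \<le> m" "m \<le> card X"
    and D: "\<And>a c. a \<in> X \<Longrightarrow> c \<in> X \<Longrightarrow> D a c \<subseteq> X \<and> card (D a c) * (8 * m ^ 3) \<le> card X"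
  shows "\<exists>Y\<subseteq>X. card Y = m \<and> (\<forall>a\<in>Y. \<forall>b\<in>Y. \<forall>c\<in>Y. a \<noteq> b \<and> b \<noteq> c \<and> a \<noteq> c \<longrightarrow> b \<notin> D a c)"
proof (rule ccontr)
  assume none: "\<not> ?thesis"
  define N where "N = card X"
  define B where "B = (SIGMA p:X \<times> X. D (fst p) (snd p))"
  define B' where "B' = {(p, b). (p, b) \<in> B \<and> fst p \<noteq> b \<and> b \<noteq> snd p \<and> fst p \<noteq> snd p}"
  define sup where "sup q = {Y. {fst (fst q), snd q, snd (fst q)} \<subseteq> Y \<and> Y \<subseteq> X \<and> card Y = m}"
    for q :: "('a \<times> 'a) \<times> 'a"
  have finD: "finite (D a c)" if "a \<in> X" "c \<in> X" for a c
    using D[OF that] fin finite_subset by blast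
  have finB: "finite B"
    unfolding B_def using fin finD by (intro finite_SigmaI) auto
  have "B' \<subseteq> B" by (auto simp: B'_def)
  then have B': "finite B'" "card B' \<le> card B"
    using finB by (auto intro: finite_subset card_mono)
  have "card B * (8 * m ^ 3) = (\<Sum>p\<in>X \<times> X. card (D (fst p) (snd p)) * (8 * m ^ 3))"
    unfolding B_def using fin finD by (subst card_SigmaI) (auto simp: sum_distrib_right)
  also have "\<dots> \<le> (\<Sum>p\<in>X \<times> X. N)"
    unfolding N_def by (rule sum_mono) (use D in auto)
  also have "\<dots> = N ^ 3"
    by (simp add: N_def power3_eq_cube card_cartesian_product)
  finally have cardB: "card B' * (8 * m ^ 3) \<le> N ^ 3"
    using B'(2) by (meson le_trans mult_le_mono1)
  have card_sup: "card (sup q) = (N - 3) choose (m - 3)" if "q \<in> B'" for q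
  proof -
    obtain a c b where q: "q = ((a, c), b)" by (metis surj_pair)
    then have "a \<noteq> b" "b \<noteq> c" "a \<noteq> c" "{a, b, c} \<subseteq> X"
      using that D[of a c] by (auto simp: B'_def B_def)
    then show ?thesis
      using card_supersets[OF fin, of "{a, b, c}" m] m
      by (simp add: sup_def q N_def numeral_3_eq_3)
  qed
  have "{Y. Y \<subseteq> X \<and> card Y = m} \<subseteq> (\<Union>q\<in>B'. sup q)"
  proof
    fix Y assume "Y \<in> {Y. Y \<subseteq> X \<and> card Y = m}"
    then have Y: "Y \<subseteq> X" "card Y = m" by auto
    with none obtain a b c where "a \<in> Y" "b \<in> Y" "c \<in> Y" "a \<noteq> b" "b \<noteq> c" "a \<noteq> c" "b \<in> D a c"
      by blast
    then have "((a, c), b) \<in> B'" "Y \<in> sup ((a, c), b)"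
      using Y by (auto simp: B'_def B_def sup_def)
    then show "Y \<in> (\<Union>q\<in>B'. sup q)" by blast
  qed
  moreover have "finite (\<Union>q\<in>B'. sup q)"
    by (rule finite_subset[of _ "Pow X"]) (use fin in \<open>auto simp: sup_def\<close>)
  ultimately have "card {Y. Y \<subseteq> X \<and> card Y = m} \<le> card (\<Union>q\<in>B'. sup q)"
    by (rule card_mono[rotated])
  also have "\<dots> \<le> (\<Sum>q\<in>B'. card (sup q))"
    using B' by (intro card_UN_le)
  also have "\<dots> = card B' * ((N - 3) choose (m - 3))"
    using card_sup by simp
  finally have le: "N choose m \<le> card B' * ((N - 3) choose (m - 3))"
    using fin by (simp add: n_subsets N_def)
  define M where "M = N - 3"
  define l where "l = m - 3"
  have Nm: "N = Suc (Suc (Suc M))" "m = Suc (Suc (Suc l))"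
    using m by (auto simp: M_def l_def N_def)
  define C where "C = M choose l"
  have pos: "0 < C"
    using m by (simp add: C_def M_def l_def N_def)
  \<comment> \<open>The absorption identity, applied three times, expresses
    \<open>N choose m\<close> through \<open>C\<close>.\<close>
  have b: "m * (N choose m) = N * (Suc (Suc M) choose Suc (Suc l))"
    "(m - 1) * (Suc (Suc M) choose Suc (Suc l)) = (N - 1) * (Suc M choose Suc l)"
    "(m - 2) * (Suc M choose Suc l) = (N - 2) * C"
    by (simp_all only: Nm C_def Suc_times_binomial diff_Suc_1 diff_Suc_Suc numeral_2_eq_2 One_nat_def diff_zero)
  have "m * (m - 1) * (m - 2) * (N choose m) = (m - 2) * ((m - 1) * (m * (N choose m)))"
    by (simp only: mult_ac)
  also have "\<dots> = N * ((m - 2) * ((m - 1) * (Suc (Suc M) choose Suc (Suc l))))"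
    by (simp only: b mult_ac)
  also have "\<dots> = N * ((N - 1) * ((m - 2) * (Suc M choose Suc l)))"
    by (simp only: b mult_ac)
  also have "\<dots> = N * (N - 1) * (N - 2) * C"
    by (simp only: b mult.assoc)
  finally have "N * (N - 1) * (N - 2) * C = m * (m - 1) * (m - 2) * (N choose m)" ..
  also have "\<dots> \<le> m ^ 3 * (card B' * C)"
    using le unfolding power3_eq_cube C_def M_def l_def by (intro mult_le_mono) auto
  finally have "8 * (N * (N - 1) * (N - 2)) * C \<le> card B' * (8 * m ^ 3) * C"
    by (simp add: mult_ac)
  also have "\<dots> \<le> N ^ 3 * C"
    using cardB by (rule mult_le_mono1)
  finally have "8 * (N * (N - 1) * (N - 2)) \<le> N ^ 3"
    using pos by simp
  then have "N * (8 * ((N - 1) * (N - 2))) \<le> N * (N * N)"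
    by (simp add: power3_eq_cube mult_ac)
  then have "8 * ((N - 1) * (N - 2)) \<le> N * N"
    unfolding Nm by (simp only: mult_le_cancel1)
  then show False
    by (simp add: Nm algebra_simps)
qed

section \<open>The lower bound\<close>

lemma doubleton_in_subsets12: "a \<in> {1..n} \<Longrightarrow> c \<in> {1..n} \<Longrightarrow> {a, c} \<in> subsets12 n"
  by (cases "a = c") (auto simp: subsets12_def)

lemma singleton_in_subsets12: "a \<in> {1..n} \<Longrightarrow> {a} \<in> subsets12 n"
  using doubleton_in_subsets12[of a n a] by simp

lemma in_Field: "(x, y) \<in> L \<Longrightarrow> x \<in> Field L \<and> y \<in> Field L"
  by (auto simp: Field_def)

text \<open>A list extends inclusion, so \<open>{a}\<close> precedes \<open>{a, c}\<close> in it. In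
  a list containing both points, a pair below \<open>{b}\<close> therefore puts \<open>b\<close>
  above both \<open>a\<close> and \<open>c\<close>.\<close>

lemma point_below_if_pair_below:
  assumes L: "partial_linear_extension (subsets12 n) (inclusion_on (subsets12 n)) L"
    and ab: "({a, c}, {b}) \<in> L" "{a} \<in> Field L"
  shows "({a}, {b}) \<in> L"
proof -
  have fld: "{a, c} \<in> Field L"
    using ab(1) by (simp add: in_Field)
  have "Field L \<subseteq> subsets12 n"
    using L by (simp add: partial_linear_extension_def)
  then have "({a}, {a, c}) \<in> inclusion_on (subsets12 n) \<inter> (Field L \<times> Field L)"
    using fld ab(2) by (auto simp: inclusion_on_def)
  then have "({a}, {a, c}) \<in> L"
    using L by (auto simp: partial_linear_extension_def)
  moreover have "trans L"
    using L by (auto simp: partial_linear_extension_def linear_order_on_def partial_order_on_def preorder_on_def)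
  ultimately show ?thesis
    using ab(1) by (meson transD)
qed

text \<open>The common lists \<open>T\<close> are collected greedily: adding a list costs a factor \<open>s\<close> in \<open>X\<close>,
  and each point of \<open>X\<close> lies in at most \<open>k\<close> lists, so this stops with every further list
  meeting only a small part of \<open>X\<close>.\<close>

lemma homogeneous_core:
  fixes n k s :: nat and F :: "nat \<Rightarrow> 'l set"
  assumes F: "\<And>x. x \<in> {1..n} \<Longrightarrow> finite (F x) \<and> card (F x) \<le> k" and n: "0 < n"
  obtains X T where "X \<subseteq> {1..n}" "finite T" "card T \<le> k" "\<And>x. x \<in> X \<Longrightarrow> T \<subseteq> F x"
    "n \<le> card X * s ^ card T" "\<And>L. L \<notin> T \<Longrightarrow> s * card {x\<in>X. L \<in> F x} \<le> card X"
proof -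
  \<comment> \<open>\<open>Q j\<close> says that the greedy choice can reach \<open>j\<close> lists;
    a greatest such \<open>j\<close> replaces the recursion. Since \<open>0 < n\<close> keeps
    \<open>X\<close> nonempty, \<open>j\<close> is at most \<open>k\<close>.\<close>
  define Q where "Q j \<longleftrightarrow> (\<exists>X T. X \<subseteq> {1..n} \<and> finite T \<and> card T = j \<and> (\<forall>x\<in>X. T \<subseteq> F x)
    \<and> n \<le> card X * s ^ card T)" for j
  have bound: "j \<le> k" if Qj: "Q j" for j
  proof -
    obtain X T where XT: "X \<subseteq> {1..n}" "finite T" "card T = j" "\<forall>x\<in>X. T \<subseteq> F x"
      "n \<le> card X * s ^ card T"
      using Qj unfolding Q_def by blast
    then obtain x where "x \<in> X" using n by (cases "X = {}") auto
    then have "finite (F x)" "card (F x) \<le> k" "T \<subseteq> F x"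
      using XT(1,4) F[of x] by auto
    then have "card T \<le> k"
      by (meson card_mono order_trans)
    then show ?thesis using XT(3) by simp
  qed
  have "Q 0"
    unfolding Q_def by (intro exI[of _ "{1..n}"] exI[of _ "{}"]) auto
  have "Q (Greatest Q)" "\<And>i. Q i \<Longrightarrow> i \<le> Greatest Q"
    using \<open>Q 0\<close> bound by (blast intro: GreatestI_nat Greatest_le_nat)+
  then obtain j where j: "Q j" "\<And>i. Q i \<Longrightarrow> i \<le> j"
    by blast
  then obtain X T where XT: "X \<subseteq> {1..n}" "finite T" "card T = j" "\<forall>x\<in>X. T \<subseteq> F x"
    "n \<le> card X * s ^ card T"
    unfolding Q_def by blast
  have "s * card {x\<in>X. L \<in> F x} \<le> card X" if L: "L \<notin> T" for L
  proof (rule ccontr)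
    assume "\<not> ?thesis"
    then have "card X * s ^ j \<le> s * card {x\<in>X. L \<in> F x} * s ^ j"
      by (intro mult_le_mono1) simp
    then have "n \<le> s * card {x\<in>X. L \<in> F x} * s ^ j"
      using XT(3,5) by (metis order_trans)
    then have "n \<le> card {x\<in>X. L \<in> F x} * s ^ card (insert L T)"
      using XT(2,3) L by (simp add: mult_ac)
    moreover have "{x\<in>X. L \<in> F x} \<subseteq> {1..n}" "finite (insert L T)" "card (insert L T) = Suc j"
      "\<forall>x\<in>{x\<in>X. L \<in> F x}. insert L T \<subseteq> F x"
      using XT(1-4) L by auto
    ultimately have "Q (Suc j)"
      unfolding Q_def by blast
    then show False using j(2) by fastforce
  qed
  then show ?thesis
    using XT bound[OF j(1)] by (intro that[of X T]) auto
qed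

text \<open>Turns a list into the injective numbering expected by
  \<open>between_in_all_orders\<close>. The rank counts points weakly below, so passing from
  \<open>x\<close> to a later \<open>y\<close> adds at least \<open>y\<close> itself.\<close>

lemma singleton_rank:
  assumes L: "linear_order_on (Field L) L" and Y: "finite Y" "\<And>x. x \<in> Y \<Longrightarrow> {x} \<in> Field L"
  defines "rk \<equiv> \<lambda>x. card {y\<in>Y. ({y}, {x}) \<in> L}"
  shows "inj_on rk Y" "\<And>x y. x \<in> Y \<Longrightarrow> y \<in> Y \<Longrightarrow> ({x}, {y}) \<in> L \<Longrightarrow> rk x \<le> rk y"
proof -
  have trans: "trans L" and antisym: "antisym L" and total: "total_on (Field L) L" and refl: "refl_on (Field L) L"
    using L by (auto simp: linear_order_on_def partial_order_on_def preorder_on_def)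
  show mono: "rk x \<le> rk y" if "x \<in> Y" "y \<in> Y" "({x}, {y}) \<in> L" for x y
    unfolding rk_def using Y that trans by (intro card_mono) (auto dest: transD)
  have strict: "rk x < rk y" if "x \<in> Y" "y \<in> Y" "({x}, {y}) \<in> L" "x \<noteq> y" for x y
  proof -
    have "({y}, {y}) \<in> L" using refl Y that by (auto simp: refl_on_def)
    moreover have "({y}, {x}) \<notin> L" using antisym that by (auto dest: antisymD)
    ultimately show ?thesis
      unfolding rk_def using Y that trans by (intro psubset_card_mono psubsetI) (auto dest: transD)
  qed
  show "inj_on rk Y"
  proof (rule inj_onI, rule ccontr)
    fix x y assume xy: "x \<in> Y" "y \<in> Y" "rk x = rk y" "x \<noteq> y"
    then have "({x}, {y}) \<in> L \<or> ({y}, {x}) \<in> L"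
      using total Y by (auto simp: total_on_def)
    then show False using strict xy by force
  qed
qed

text \<open>In \<open>8 * k * m ^ 3\<close> the factor \<open>k\<close> pays for the union over the
  lists containing a pair, and \<open>8 * m ^ 3\<close> is what \<open>free_set_exists\<close>
  demands. The leading \<open>m\<close> leaves at least \<open>m\<close> points in the core, where
  \<open>m\<close> just exceeds \<open>2 ^ 2 ^ k\<close>.\<close>

lemma local_realizer_lower_bound:
  assumes R: "local_realizer (subsets12 n) (inclusion_on (subsets12 n)) \<L>"
    and mult: "\<And>x. x \<in> subsets12 n \<Longrightarrow> finite {L\<in>\<L>. x \<in> Field L} \<and> card {L\<in>\<L>. x \<in> Field L} \<le> k"
    and k: "0 < k" and m: "m = 2 ^ 2 ^ k + 1"
  shows "n < m * (8 * k * m ^ 3) ^ k"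
proof (rule ccontr)
  assume "\<not> ?thesis"
  then have n: "m * (8 * k * m ^ 3) ^ k \<le> n" by simp
  define s where "s = 8 * k * m ^ 3"
  have s: "0 < s" using k m by (simp add: s_def)
  have "0 < m * s ^ k" using s m by simp
  then have n0: "0 < n" using n unfolding s_def by linarith
  have PLE: "partial_linear_extension (subsets12 n) (inclusion_on (subsets12 n)) L" if "L \<in> \<L>" for L
    using R that by (auto simp: local_realizer_def)
  define F where "F x = {L\<in>\<L>. {x} \<in> Field L}" for x
  have "finite (F x) \<and> card (F x) \<le> k" if "x \<in> {1..n}" for x
    using mult singleton_in_subsets12[OF that] by (simp add: F_def)
  from homogeneous_core[of n F k s, OF this n0]
  obtain X T where X: "X \<subseteq> {1..n}" and T: "finite T" "card T \<le> k" "\<And>x. x \<in> X \<Longrightarrow> T \<subseteq> F x"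
    and XT: "n \<le> card X * s ^ card T" "\<And>L. L \<notin> T \<Longrightarrow> s * card {x\<in>X. L \<in> F x} \<le> card X"
    by blast
  have finX: "finite X" using X finite_subset by blast
  have "m * s ^ card T \<le> m * s ^ k"
    using s T(2) by (intro mult_le_mono2 power_increasing) auto
  also have "\<dots> \<le> card X * s ^ card T"
    using n XT(1) by (simp add: s_def)
  finally have cardX: "m \<le> card X" using s by simp
  have m3: "3 \<le> m"
  proof -
    have "(2::nat) ^ 1 \<le> 2 ^ 2 ^ k" by (intro power_increasing) auto
    then show ?thesis using m by simp
  qed
  \<comment> \<open>\<open>D a c\<close> holds the points of \<open>X\<close> that meet
    \<open>{a, c}\<close> in a list outside \<open>T\<close>; on a free set for \<open>D\<close>, a
    pair meets a third point only in lists from \<open>T\<close>.\<close>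
  define D where "D a c = {x\<in>X. \<exists>L\<in>\<L> - T. {a, c} \<in> Field L \<and> {x} \<in> Field L}" for a c
  have D: "D a c \<subseteq> X \<and> card (D a c) * (8 * m ^ 3) \<le> card X" if ac: "a \<in> X" "c \<in> X" for a c
  proof
    show "D a c \<subseteq> X" by (auto simp: D_def)
    define A where "A = {L\<in>\<L> - T. {a, c} \<in> Field L}"
    have "{a, c} \<in> subsets12 n"
      using ac X by (intro doubleton_in_subsets12) auto
    from mult[OF this] have "finite {L\<in>\<L>. {a, c} \<in> Field L}" "card {L\<in>\<L>. {a, c} \<in> Field L} \<le> k"
      by auto
    moreover have "A \<subseteq> {L\<in>\<L>. {a, c} \<in> Field L}" by (auto simp: A_def)
    ultimately have A: "finite A" "card A \<le> k"
      by (auto intro: finite_subset dest: card_mono order_trans)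
    have "D a c \<subseteq> (\<Union>L\<in>A. {x\<in>X. L \<in> F x})"
      by (auto simp: D_def A_def F_def)
    then have "card (D a c) \<le> card (\<Union>L\<in>A. {x\<in>X. L \<in> F x})"
      using finX A by (intro card_mono) auto
    also have "\<dots> \<le> (\<Sum>L\<in>A. card {x\<in>X. L \<in> F x})"
      using A by (intro card_UN_le)
    finally have "s * card (D a c) \<le> (\<Sum>L\<in>A. s * card {x\<in>X. L \<in> F x})"
      by (simp flip: sum_distrib_left)
    also have "\<dots> \<le> (\<Sum>L\<in>A. card X)"
      using XT(2) by (intro sum_mono) (auto simp: A_def)
    also have "\<dots> \<le> k * card X"
      using A by simp
    finally have "k * (card (D a c) * (8 * m ^ 3)) \<le> k * card X"
      by (simp add: s_def mult_ac)
    then show "card (D a c) * (8 * m ^ 3) \<le> card X"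
      using k by (simp only: mult_le_cancel1)
  qed
  have "\<exists>Y\<subseteq>X. card Y = m \<and>
      (\<forall>a\<in>Y. \<forall>b\<in>Y. \<forall>c\<in>Y. a \<noteq> b \<and> b \<noteq> c \<and> a \<noteq> c \<longrightarrow> b \<notin> D a c)"
    by (rule free_set_exists[OF finX m3 cardX]) (rule D)
  then obtain Y where Y: "Y \<subseteq> X" "card Y = m"
    and free: "\<forall>a\<in>Y. \<forall>b\<in>Y. \<forall>c\<in>Y. a \<noteq> b \<and> b \<noteq> c \<and> a \<noteq> c \<longrightarrow> b \<notin> D a c"
    by (elim exE conjE)
  have finY: "finite Y" using Y finX finite_subset by blast
  define rk where "rk L x = card {y\<in>Y. ({y}, {x}) \<in> L}" for L :: "nat set rel" and x
  have TF: "L \<in> \<L>" "{x} \<in> Field L" if "L \<in> T" "x \<in> Y" for L x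
    using T(3)[of x] that Y by (auto simp: F_def)
  have Tlin: "linear_order_on (Field L) L" if "L \<in> T" for L
  proof -
    obtain y where "y \<in> Y" using Y m3 by fastforce
    then show ?thesis
      using PLE TF that by (auto simp: partial_linear_extension_def)
  qed
  have inj: "inj_on (rk L) Y" if "L \<in> T" for L
    unfolding rk_def using singleton_rank(1)[OF Tlin[OF that] finY] TF that by blast
  have rk_mono: "rk L x \<le> rk L y" if "L \<in> T" "x \<in> Y" "y \<in> Y" "({x}, {y}) \<in> L" for L x y
    unfolding rk_def using singleton_rank(2)[OF Tlin[OF that(1)] finY] TF that by blast
  have "(2::nat) ^ 2 ^ card T \<le> 2 ^ 2 ^ k"
    using T(2) by (intro power_increasing) auto
  then have "2 ^ 2 ^ card T < card Y"
    using Y(2) m by linarith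
  \<comment> \<open>The reference order \<open>g\<close> is the usual order of numbers.\<close>
  with between_in_all_orders[OF T(1) finY inj_on_id2[of Y], of rk] inj
  obtain a b c where abc: "a \<in> Y" "b \<in> Y" "c \<in> Y" "a < b" "b < c"
    and between: "\<And>L. L \<in> T \<Longrightarrow> rk L a < rk L b \<and> rk L b < rk L c \<or> rk L c < rk L b \<and> rk L b < rk L a"
    by blast
  have "{a, c} \<in> subsets12 n" "{b} \<in> subsets12 n"
    using abc Y X by (auto intro!: doubleton_in_subsets12 singleton_in_subsets12)
  moreover have "({a, c}, {b}) \<notin> inclusion_on (subsets12 n)" "({b}, {a, c}) \<notin> inclusion_on (subsets12 n)"
    using abc by (auto simp: inclusion_on_def)
  ultimately obtain L where L: "L \<in> \<L>" "({a, c}, {b}) \<in> L"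
    using R unfolding local_realizer_def by blast
  \<comment> \<open>If \<open>L\<close> is in \<open>T\<close>, then \<open>b\<close> lies above
    both ends, against betweenness; otherwise \<open>b\<close> falls into \<open>D a c\<close>,
    against freeness.\<close>
  show False
  proof (cases "L \<in> T")
    case True
    have "({a}, {b}) \<in> L" "({c}, {b}) \<in> L"
      using point_below_if_pair_below[OF PLE[OF L(1)], of a c b]
        point_below_if_pair_below[OF PLE[OF L(1)], of c a b] L(2) TF[OF True] abc
      by (auto simp: insert_commute)
    then show False
      using rk_mono[OF True] between[OF True] abc by (meson leD)
  next
    case False
    then have "b \<in> D a c"
      using L abc Y in_Field[OF L(2)] by (auto simp: D_def)
    then show False using free abc by auto
  qed
qed

section \<open>The upper bound\<close>

lemma set_encode_less_power: "A \<subseteq> {..<p} \<Longrightarrow> set_encode A < 2 ^ p"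
proof -
  assume "A \<subseteq> {..<p}"
  then have "set_encode A \<le> (\<Sum>i<p. 2 ^ i)"
    unfolding set_encode_def by (intro sum_mono2) auto
  also have "\<dots> = 2 ^ p - 1"
    using mask_eq_sum_exp_nat[of p] by (simp add: lessThan_def)
  finally show ?thesis
    by (simp add: le_less_trans)
qed

lemma power_le_set_encode: "finite A \<Longrightarrow> p \<in> A \<Longrightarrow> 2 ^ p \<le> set_encode A"
  unfolding set_encode_def by (rule member_le_sum) auto

text \<open>The highest differing bit decides: the parts above \<open>p\<close> agree, the rest of
  \<open>A\<close> sums to less than \<open>2 ^ p\<close>, and \<open>B\<close> contains
  \<open>p\<close>.\<close>

lemma set_encode_less:
  assumes fin: "finite A" "finite B" and p: "p \<in> B" "p \<notin> A" and eq: "\<And>q. p < q \<Longrightarrow> q \<in> A \<longleftrightarrow> q \<in> B"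
  shows "set_encode A < set_encode B"
proof -
  have split: "set_encode C = set_encode (C \<inter> {p<..}) + set_encode (C \<inter> {..p})" if "finite C" for C
    unfolding set_encode_def using that
    by (subst sum.union_disjoint[symmetric]) (auto intro!: sum.cong)
  have "A \<inter> {p<..} = B \<inter> {p<..}" using eq by auto
  moreover have "A \<inter> {..p} \<subseteq> {..<p}" using p(2) by (auto simp: order_le_less)
  moreover have "2 ^ p \<le> set_encode (B \<inter> {..p})" using fin p(1) by (intro power_le_set_encode) auto
  ultimately show ?thesis
    using split[OF fin(1)] split[OF fin(2)] set_encode_less_power[of "A \<inter> {..p}" p] by simp
qed

text \<open>Bitwise exclusive or of \<open>x\<close> with the mask \<open>S\<close>.\<close>

definition flip :: "nat set \<Rightarrow> nat \<Rightarrow> nat" where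
  "flip S x = set_encode (sym_diff (set_decode x) S)"

definition top_diff :: "nat \<Rightarrow> nat \<Rightarrow> nat" where
  "top_diff x y = Max (sym_diff (set_decode x) (set_decode y))"

lemma top_diff:
  assumes "x \<noteq> y"
  shows "(top_diff x y \<in> set_decode x) \<noteq> (top_diff x y \<in> set_decode y)"
    and "top_diff x y < q \<Longrightarrow> q \<in> set_decode x \<longleftrightarrow> q \<in> set_decode y"
proof -
  have "set_decode x \<noteq> set_decode y"
    using assms by (metis set_decode_inverse)
  then have "top_diff x y \<in> sym_diff (set_decode x) (set_decode y)"
    unfolding top_diff_def by (intro Max_in) auto
  then show "(top_diff x y \<in> set_decode x) \<noteq> (top_diff x y \<in> set_decode y)"
    by auto
  show "q \<in> set_decode x \<longleftrightarrow> q \<in> set_decode y" if "top_diff x y < q"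
  proof (rule ccontr)
    assume "\<not> ?thesis"
    then have "q \<le> top_diff x y"
      unfolding top_diff_def by (intro Max_ge) auto
    then show False using that by simp
  qed
qed

lemma top_diff_less:
  assumes "x \<noteq> y" "x < 2 ^ M" "y < 2 ^ M"
  shows "top_diff x y < M"
proof -
  have "p < M" if "p \<in> set_decode z" "z < 2 ^ M" for p z
  proof (rule ccontr)
    assume "\<not> p < M"
    then have "z < 2 ^ p"
      using that(2) power_increasing[of M p "2::nat"] by linarith
    then show False using that(1) by (simp add: set_decode_def)
  qed
  then show ?thesis
    using top_diff(1)[OF assms(1)] assms by blast
qed

text \<open>Flipping the same bits in both numbers preserves the positions where they differ. The
  leading difference stays put, and \<open>y\<close> becomes the larger number exactly when its bit
  there is 1 after the flip.\<close>

lemma flip_less: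
  assumes "finite S" "x \<noteq> y" "top_diff x y \<in> S \<longleftrightarrow> top_diff x y \<notin> set_decode y"
  shows "flip S x < flip S y"
  unfolding flip_def using assms top_diff[OF assms(2)]
  by (intro set_encode_less[of _ _ "top_diff x y"]) auto

lemma inj_flip: "finite S \<Longrightarrow> inj (flip S)"
proof (rule injI)
  fix x y assume "finite S" "flip S x = flip S y"
  then have "sym_diff (set_decode x) S = sym_diff (set_decode y) S"
    by (simp add: flip_def set_encode_eq)
  then have "set_decode x = set_decode y" by blast
  then show "x = y" by (metis set_decode_inverse)
qed

text \<open>The colexicographic order of the images under \<open>flip S\<close>: comparing the
  encodings as binary numbers compares largest elements first.\<close>

definition flip_order :: "nat \<Rightarrow> nat set \<Rightarrow> nat set rel" where
  "flip_order n S = {(A, B). A \<in> subsets12 n \<and> B \<in> subsets12 n \<and>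
     set_encode (flip S ` A) \<le> set_encode (flip S ` B)}"

lemma Field_flip_order: "Field (flip_order n S) = subsets12 n"
  by (auto simp: flip_order_def Field_def)

lemma finite_in_subsets12: "A \<in> subsets12 n \<Longrightarrow> finite A"
  by (auto simp: subsets12_def intro: finite_subset)

lemma partial_linear_extension_flip_order:
  assumes "finite S"
  shows "partial_linear_extension (subsets12 n) (inclusion_on (subsets12 n)) (flip_order n S)"
proof -
  have inj: "A = B" if "A \<in> subsets12 n" "B \<in> subsets12 n"
    "set_encode (flip S ` A) = set_encode (flip S ` B)" for A B
    using that inj_flip[OF assms] by (simp add: finite_in_subsets12 set_encode_eq inj_image_eq_iff)
  have mono: "set_encode (flip S ` A) \<le> set_encode (flip S ` B)" if "finite B" "A \<subseteq> B" for A B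
    unfolding set_encode_def using that by (intro sum_mono2) auto
  have "linear_order_on (subsets12 n) (flip_order n S)"
    unfolding linear_order_on_def partial_order_on_def preorder_on_def refl_on_def trans_def
      antisym_def total_on_def flip_order_def
    using inj by (auto simp: linear)
  moreover have "inclusion_on (subsets12 n) \<subseteq> flip_order n S"
    using mono by (auto simp: inclusion_on_def flip_order_def finite_in_subsets12)
  ultimately show ?thesis
    by (auto simp: partial_linear_extension_def Field_flip_order)
qed

text \<open>Whenever \<open>B\<close> is not contained in \<open>A\<close>, some \<open>b\<close> in
  \<open>B - A\<close> can be put above all of \<open>A\<close>, and the colexicographic order then
  places \<open>B\<close> after \<open>A\<close>. This single case serves comparable and
  incomparable pairs alike.\<close>

lemma flip_orders_realize:
  assumes Ss: "Ss \<noteq> {}" "\<And>S. S \<in> Ss \<Longrightarrow> finite S"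
    and above: "\<And>a b c. a \<in> {1..n} \<Longrightarrow> b \<in> {1..n} \<Longrightarrow> c \<in> {1..n} \<Longrightarrow> a \<noteq> b \<Longrightarrow> c \<noteq> b \<Longrightarrow>
      \<exists>S\<in>Ss. flip S a < flip S b \<and> flip S c < flip S b"
  shows "local_realizer (subsets12 n) (inclusion_on (subsets12 n)) (flip_order n ` Ss)"
proof -
  have below: "\<exists>L\<in>flip_order n ` Ss. (A, B) \<in> L"
    if AB: "A \<in> subsets12 n" "B \<in> subsets12 n" "(B, A) \<notin> inclusion_on (subsets12 n)" for A B
  proof -
    obtain b where b: "b \<in> B" "b \<notin> A"
      using AB by (auto simp: inclusion_on_def)
    \<comment> \<open>The choice \<open>a = c\<close> covers singletons.\<close>
    obtain a c where A: "A = {a, c}"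
      using AB(1) by (auto simp: subsets12_def card_1_singleton_iff card_2_iff)
    have "a \<in> {1..n}" "b \<in> {1..n}" "c \<in> {1..n}" "a \<noteq> b" "c \<noteq> b"
      using AB b A by (auto simp: subsets12_def)
    from above[OF this] obtain S where S: "S \<in> Ss" "flip S a < flip S b" "flip S c < flip S b"
      by blast
    have "set_encode (flip S ` A) < 2 ^ flip S b"
      using S A by (intro set_encode_less_power) auto
    also have "\<dots> \<le> set_encode (flip S ` B)"
      using b AB by (intro power_le_set_encode) (auto simp: finite_in_subsets12)
    finally show ?thesis
      using S AB by (intro bexI[of _ "flip_order n S"]) (auto simp: flip_order_def)
  qed
  have "(B, A) \<notin> inclusion_on (subsets12 n)"
    if "A \<noteq> B" "(A, B) \<in> inclusion_on (subsets12 n)" for A B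
    using that by (auto simp: inclusion_on_def)
  then show ?thesis
    using Ss below partial_linear_extension_flip_order unfolding local_realizer_def by auto
qed

text \<open>Sets of size \<open>r\<close> in \<open>{..<2 * r}\<close> that share the point \<open>0\<close> are pairwise qualitatively
  independent: no union of two of them is everything.\<close>

lemma qualitatively_independent_family:
  assumes r: "0 < r" and M: "M \<le> (2 * r - 1) choose (r - 1)"
  obtains V :: "nat \<Rightarrow> nat set" where
    "\<And>p q s t. p < M \<Longrightarrow> q < M \<Longrightarrow> (p = q \<Longrightarrow> s = t) \<Longrightarrow> \<exists>i<2 * r. (i \<in> V p) = s \<and> (i \<in> V q) = t"
proof -
  define W where "W = {Y. {0} \<subseteq> Y \<and> Y \<subseteq> {..<2 * r} \<and> card Y = r}"
  \<comment> \<open>Besides \<open>0\<close>, a member chooses \<open>r - 1\<close> of the remaining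
    \<open>2 * r - 1\<close> elements.\<close>
  have "card W = (2 * r - 1) choose (r - 1)"
    unfolding W_def using r by (subst card_supersets) auto
  moreover have "finite W"
    by (rule finite_subset[of _ "Pow {..<2 * r}"]) (auto simp: W_def)
  ultimately obtain V where V: "V ` {..<M} \<subseteq> W" "inj_on V {..<M}"
    using card_le_inj[of "{..<M}" W] M by auto
  have VW: "0 \<in> V p" "V p \<subseteq> {..<2 * r}" "card (V p) = r" "finite (V p)" if "p < M" for p
    using V(1) that finite_subset[of "V p" "{..<2 * r}"] by (auto simp: W_def)
  have diff: "\<exists>i<2 * r. i \<in> V p \<and> i \<notin> V q" if pq: "p < M" "q < M" "p \<noteq> q" for p q
  proof (rule ccontr)
    assume "\<not> ?thesis"
    then have "V p \<subseteq> V q" using VW pq by blast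
    then have "V p = V q" using VW pq by (intro card_subset_eq) auto
    then show False using V(2) pq by (auto dest: inj_onD)
  qed
  have none: "\<exists>i<2 * r. i \<notin> V p \<and> i \<notin> V q" if pq: "p < M" "q < M" for p q
  proof (rule ccontr)
    assume "\<not> ?thesis"
    then have "{..<2 * r} \<subseteq> V p \<union> V q" by auto
    then have "card {..<2 * r} \<le> card (V p \<union> V q)"
      using VW pq by (intro card_mono) auto
    moreover have "card (V p) + card (V q) = card (V p \<union> V q) + card (V p \<inter> V q)"
      using VW pq by (intro card_Un_Int) auto
    moreover have "0 \<in> V p \<inter> V q" "finite (V p \<inter> V q)"
      using VW pq by auto
    then have "0 < card (V p \<inter> V q)"
      by (metis card_gt_0_iff empty_iff)
    ultimately show False using VW pq by simp
  qed
  show ?thesis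
  proof (rule that[of V])
    fix p q and s t :: bool assume pq: "p < M" "q < M" and st: "p = q \<Longrightarrow> s = t"
    \<comment> \<open>The four patterns come from the common point \<open>0\<close>, from the
      differences in either direction of distinct sets of equal size, and from a point outside the
      union. For \<open>p = q\<close> the mixed patterns are excluded by \<open>st\<close>.\<close>
    show "\<exists>i<2 * r. (i \<in> V p) = s \<and> (i \<in> V q) = t"
    proof (cases s; cases t)
      assume "s" "t"
      then show ?thesis using VW pq r by (intro exI[of _ 0]) auto
    next
      assume "s" "\<not> t"
      then show ?thesis using diff[of p q] pq st by auto
    next
      assume "\<not> s" "t"
      then show ?thesis using diff[of q p] pq st by auto
    next
      assume "\<not> s" "\<not> t"
      then show ?thesis using none[of p q] pq by auto
    qed
  qed
qed

text \<open>The masks \<open>S i\<close> form the dual of the family \<open>V\<close>, so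
  prescribing flips at two positions means finding an \<open>i\<close> with a given pattern. As
  \<open>n < 2 ^ M\<close>, all leading differences lie below \<open>M\<close>, and multiplicity is
  bounded by the number of orders.\<close>

lemma local_realizer_exists:
  assumes r: "0 < r" and M: "M \<le> (2 * r - 1) choose (r - 1)" and n: "n < 2 ^ M"
  shows "\<exists>\<L>. local_realizer (subsets12 n) (inclusion_on (subsets12 n)) \<L> \<and>
    (\<forall>x\<in>subsets12 n. finite {L\<in>\<L>. x \<in> Field L} \<and> card {L\<in>\<L>. x \<in> Field L} \<le> 2 * r)"
proof -
  from qualitatively_independent_family[OF r M] obtain V :: "nat \<Rightarrow> nat set" where
    V: "\<And>p q s t. p < M \<Longrightarrow> q < M \<Longrightarrow> (p = q \<Longrightarrow> s = t) \<Longrightarrow> \<exists>i<2 * r. (i \<in> V p) = s \<and> (i \<in> V q) = t"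
    by blast
  define S where "S i = {p. p < M \<and> i \<in> V p}" for i
  have "local_realizer (subsets12 n) (inclusion_on (subsets12 n)) (flip_order n ` S ` {..<2 * r})"
  proof (rule flip_orders_realize)
    show "S ` {..<2 * r} \<noteq> {}" using r by (simp add: lessThan_empty_iff)
    show "finite T" if "T \<in> S ` {..<2 * r}" for T
      using that by (auto simp: S_def)
    fix a b c assume abc: "a \<in> {1..n}" "b \<in> {1..n}" "c \<in> {1..n}" "a \<noteq> b" "c \<noteq> b"
    define p where "p = top_diff a b"
    define q where "q = top_diff c b"
    have pq: "p < M" "q < M"
      unfolding p_def q_def using abc n by (auto intro!: top_diff_less)
    \<comment> \<open>If \<open>p = q\<close>, both prescribed values come from the same bit of
      \<open>b\<close>, so they agree as \<open>V\<close> requires.\<close>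
    obtain i where i: "i < 2 * r" "(i \<in> V p) = (p \<notin> set_decode b)" "(i \<in> V q) = (q \<notin> set_decode b)"
      using V[OF pq, of "p \<notin> set_decode b" "q \<notin> set_decode b"] by auto
    have "flip (S i) a < flip (S i) b" "flip (S i) c < flip (S i) b"
      using i pq abc unfolding p_def q_def by (auto intro!: flip_less simp: S_def)
    then show "\<exists>T\<in>S ` {..<2 * r}. flip T a < flip T b \<and> flip T c < flip T b"
      using i(1) by blast
  qed
  moreover have "finite {L\<in>flip_order n ` S ` {..<2 * r}. x \<in> Field L} \<and>
      card {L\<in>flip_order n ` S ` {..<2 * r}. x \<in> Field L} \<le> 2 * r" for x
  proof -
    have "card {L\<in>flip_order n ` S ` {..<2 * r}. x \<in> Field L} \<le> card (flip_order n ` S ` {..<2 * r})"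
      by (intro card_mono) auto
    also have "\<dots> \<le> card {..<2 * r}"
      by (metis card_image_le finite_imageI finite_lessThan order_trans)
    finally show ?thesis by auto
  qed
  ultimately show ?thesis by blast
qed

section \<open>Asymptotics\<close>

text \<open>The coefficient is half the central one, which is at least
  \<open>4 ^ r / (2 * r)\<close>.\<close>

lemma le_half_central_binomial:
  assumes r: "0 < r" and M: "4 * r * M \<le> 4 ^ r"
  shows "M \<le> (2 * r - 1) choose (r - 1)"
proof -
  obtain l where l: "r = Suc l" using r by (cases r) auto
  have "(2 * r) choose r = 2 * ((2 * r - 1) choose (r - 1))"
    using binomial_symmetric[of l "Suc (2 * l)"] by (simp add: l)
  moreover have "real (4 * r * M) \<le> real (4 ^ r)"
    using M by (simp only: of_nat_le_iff)
  then have "real M \<le> 4 ^ r / (4 * real r)"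
    using r by (simp add: le_divide_eq mult_ac)
  ultimately have "real M \<le> real ((2 * r - 1) choose (r - 1))"
    using central_binomial_lower_bound[OF r] by (simp add: field_simps)
  then show ?thesis by simp
qed

lemma log2_two_power: "log 2 4 = 2" "log 2 8 = 3" "log 2 16 = 4"
  using log_pow_cancel[of 2 2] log_pow_cancel[of 2 3] log_pow_cancel[of 2 4] by simp_all

lemma log2_le_double:
  assumes "0 < (u::real)"
  shows "log 2 u \<le> 2 * u"
proof -
  have "1 / 2 \<le> ln (2::real)"
    using ln_le_minus_one[of "1 / 2"] by (simp add: ln_div)
  then have "u \<le> 2 * u * ln 2"
    using mult_left_mono[of "1 / 2" "ln 2" "2 * u"] assms by simp
  moreover have "ln u \<le> u"
    using ln_le_minus_one[OF assms] by simp
  ultimately show ?thesis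
    by (simp add: log_def divide_le_eq)
qed

lemma log2_less_self: "0 < k \<Longrightarrow> log 2 (real k) < real k"
  by (simp add: log_less_iff powr_realpow of_nat_less_two_power)

lemma log_log_ge_two:
  assumes "16 \<le> (n::nat)"
  shows "4 \<le> log 2 (real n)" "2 \<le> log 2 (log 2 (real n))"
proof -
  show 4: "4 \<le> log 2 (real n)"
    using assms by (simp add: le_log_iff powr_numeral)
  then show "2 \<le> log 2 (log 2 (real n))"
    by (simp add: le_log_iff powr_numeral)
qed

text \<open>\<open>M\<close> is the bit length of \<open>n\<close> and \<open>r\<close> is least
  with \<open>4 * r * M \<le> 4 ^ r\<close>. Failure at \<open>l = r - 1\<close> gives
  \<open>2 * l < 2 + log 2 l + log 2 M\<close>. The crude \<open>log 2 l < l\<close> first yields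
  \<open>l \<le> 4 * u\<close>; fed back, this sharpens \<open>log 2 l\<close> to at most
  \<open>2 + log 2 u\<close>.\<close>

lemma upper_bound_parameters:
  assumes n: "16 \<le> (n::nat)"
  defines "u \<equiv> log 2 (log 2 (real n))"
  obtains r M where "0 < r" "M \<le> (2 * r - 1) choose (r - 1)" "n < 2 ^ M" "2 * real r \<le> u + log 2 u + 7"
proof -
  note ln = log_log_ge_two[OF n]
  define M where "M = nat \<lfloor>log 2 (real n)\<rfloor> + 1"
  have M: "log 2 (real n) < real M" "real M \<le> log 2 (real n) + 1"
    unfolding M_def using ln by linarith+
  have "real n < 2 ^ M"
    using M(1) n by (simp add: log_less_iff powr_realpow)
  then have nM: "n < 2 ^ M"
    by (metis of_nat_less_iff of_nat_numeral of_nat_power)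
  have M2: "2 \<le> M" using M(1) ln by linarith
  define P where "P r \<longleftrightarrow> 0 < r \<and> 4 * r * M \<le> 4 ^ r" for r
  \<comment> \<open>\<open>Suc M\<close> satisfies \<open>P\<close>, so a least \<open>r\<close>
    exists.\<close>
  have "Suc M * M \<le> 2 ^ M * 2 ^ M"
    using less_exp[of M] by (intro mult_le_mono Suc_leI less_imp_le)
  also have "\<dots> = 4 ^ M"
    by (simp flip: power_mult_distrib)
  finally have "4 * (Suc M * M) \<le> 4 * 4 ^ M"
    by (rule mult_le_mono2)
  then have "P (Suc M)" by (simp only: P_def mult.assoc power_Suc zero_less_Suc simp_thms)
  then obtain r where r: "P r" "\<And>i. i < r \<Longrightarrow> \<not> P i"
    using exists_least_iff[of P] by blast
  \<comment> \<open>\<open>r = 1\<close> would force \<open>M \<le> 1\<close>. Hence the predecessor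
    \<open>l\<close> is positive and its failure of \<open>P\<close> is a genuine
    inequality.\<close>
  have "r \<noteq> 1" using r(1) M2 by (auto simp: P_def)
  then obtain l where l: "r = Suc l" "0 < l"
    using r(1) by (cases r) (auto simp: P_def)
  have "4 ^ l < 4 * l * M" using r(2)[of l] l by (simp add: P_def)
  then have "real (4 ^ l) < real (4 * l * M)"
    by (simp only: of_nat_less_iff)
  then have "(4::real) ^ l < 4 * real l * real M"
    by simp
  then have "log 2 (4 ^ l) < log 2 (4 * real l * real M)"
    using l M2 by (subst log_less_cancel_iff) auto
  moreover have "log 2 (4 ^ l) = 2 * real l"
    by (simp add: log_nat_power log2_two_power)
  moreover have "log 2 (4 * real l * real M) = 2 + log 2 l + log 2 M"
    using l M2 by (simp add: log_mult log2_two_power)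
  ultimately have l_less: "2 * real l < 2 + log 2 l + log 2 M" by simp
  then have "real l < 2 + log 2 M"
    using log2_less_self[OF l(2)] by linarith
  moreover have "log 2 (real M) \<le> log 2 (2 * log 2 (real n))"
    using M M2 ln by (subst log_le_cancel_iff) auto
  then have logM: "log 2 (real M) \<le> 1 + u"
    using ln by (simp add: log_mult u_def)
  ultimately have "real l \<le> 4 * u"
    using ln by (simp add: u_def)
  then have "log 2 (real l) \<le> log 2 (4 * u)"
    using l ln by (subst log_le_cancel_iff) (auto simp: u_def)
  also have "\<dots> = 2 + log 2 u"
    using ln by (simp add: log_mult log2_two_power u_def)
  finally have "2 * real r \<le> u + log 2 u + 7"
    using l_less logM by (simp add: l)
  moreover have "0 < r" "M \<le> (2 * r - 1) choose (r - 1)"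
    using r(1) le_half_central_binomial by (auto simp: P_def)
  ultimately show ?thesis using nM that by blast
qed

text \<open>With \<open>q = 2 ^ k\<close> we have \<open>m \<le> 2 ^ (q + 1)\<close>, so the bound
  on \<open>n\<close> is at most \<open>2 ^ (8 * (k * q))\<close>: the exponent is dominated by its
  multiples of \<open>k * q\<close>. Two logarithms then give
  \<open>k + log 2 k + 3\<close>.\<close>

lemma lower_bound_estimate:
  assumes k: "0 < k" and m: "m = 2 ^ 2 ^ k + 1" and n: "16 \<le> n" "n < m * (8 * k * m ^ 3) ^ k"
  shows "log 2 (log 2 (real n)) \<le> k + log 2 k + 3"
proof -
  define q :: nat where "q = 2 ^ k"
  have q: "k + 1 \<le> q" using less_exp[of k] unfolding q_def by linarith
  have m': "m \<le> 2 ^ (q + 1)" by (simp add: m q_def)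
  have "8 * k \<le> 2 ^ (3 + k)" using q by (simp add: power_add q_def)
  then have "m * (8 * k * m ^ 3) ^ k \<le> 2 ^ (q + 1) * (2 ^ (3 + k) * (2 ^ (q + 1)) ^ 3) ^ k"
    using m' by (intro mult_le_mono power_mono) auto
  also have "\<dots> = 2 ^ (q + 1 + (3 + k + (q + 1) * 3) * k)"
    by (simp only: power_add power_mult)
  also have "\<dots> \<le> 2 ^ (8 * (k * q))"
  proof (rule power_increasing)
    have "1 \<le> k" using k by simp
    then have "q \<le> k * q" "1 \<le> k * k" "k \<le> k * k" by simp_all
    moreover have "k * (k + 1) \<le> k * q" using q by (intro mult_le_mono2)
    moreover have "q + 1 + (3 + k + (q + 1) * 3) * k = q + 1 + 6 * k + k * k + 3 * (k * q)"
      by (simp add: algebra_simps)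
    ultimately show "q + 1 + (3 + k + (q + 1) * 3) * k \<le> 8 * (k * q)"
      unfolding distrib_left by linarith
  qed simp
  finally have "n < 2 ^ (8 * (k * q))" using n by linarith
  then have "real n < real (2 ^ (8 * (k * q)))"
    by (simp only: of_nat_less_iff)
  then have "real n < 2 powr real (8 * (k * q))"
    by (subst powr_realpow) simp_all
  then have "log 2 (real n) < 8 * real k * 2 ^ k"
    using n by (simp add: log_less_iff q_def mult.assoc)
  then have "log 2 (log 2 (real n)) \<le> log 2 (8 * real k * 2 ^ k)"
    using log_log_ge_two[OF n(1)] k by (subst log_le_cancel_iff) auto
  also have "\<dots> = k + log 2 k + 3"
    using k by (simp add: log_mult log2_two_power log_nat_power)
  finally show ?thesis .
qed

text \<open>A \<open>LEAST\<close> says something only once a witness is known. Any realizer of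
  bounded multiplicity provides it, and the realizer attaining \<open>ldim_P12 n\<close> is then
  available for the lower bound.\<close>

lemma ldim_P12_attained:
  assumes "local_realizer (subsets12 n) (inclusion_on (subsets12 n)) \<L>"
    and "\<forall>x\<in>subsets12 n. finite {L\<in>\<L>. x \<in> Field L} \<and> card {L\<in>\<L>. x \<in> Field L} \<le> k"
  shows "ldim_P12 n \<le> k"
    and "\<exists>\<L>. local_realizer (subsets12 n) (inclusion_on (subsets12 n)) \<L> \<and>
      (\<forall>x\<in>subsets12 n. finite {L\<in>\<L>. x \<in> Field L} \<and> card {L\<in>\<L>. x \<in> Field L} \<le> ldim_P12 n)"
proof -
  show "ldim_P12 n \<le> k"
    unfolding ldim_P12_def ldim_def by (rule Least_le) (use assms in blast)
  show "\<exists>\<L>. local_realizer (subsets12 n) (inclusion_on (subsets12 n)) \<L> \<and>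
      (\<forall>x\<in>subsets12 n. finite {L\<in>\<L>. x \<in> Field L} \<and> card {L\<in>\<L>. x \<in> Field L} \<le> ldim_P12 n)"
    unfolding ldim_P12_def ldim_def by (rule LeastI) (use assms in blast)
qed

text \<open>The lower bound has its error in \<open>log 2 k\<close>; the upper bound on
  \<open>k\<close> converts this to \<open>log 2 u + 4\<close>. Both deviations are then at most
  \<open>log 2 u + 7\<close>, and \<open>1 \<le> log 2 u\<close> absorbs the constant into the
  factor 8.\<close>

lemma ldim_P12_bound:
  assumes n: "16 \<le> n"
  defines "u \<equiv> log 2 (log 2 (real n))"
  shows "\<bar>real (ldim_P12 n) - u\<bar> \<le> 8 * log 2 u"
proof -
  have u: "2 \<le> u" unfolding u_def using log_log_ge_two[OF n] by simp
  then have "log 2 2 \<le> log 2 u" by (subst log_le_cancel_iff) auto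
  then have logu: "1 \<le> log 2 u" by simp
  obtain r M where rM: "0 < r" "M \<le> (2 * r - 1) choose (r - 1)" "n < 2 ^ M"
    and r: "2 * real r \<le> u + log 2 u + 7"
    using upper_bound_parameters[OF n] unfolding u_def by blast
  obtain \<L> where "local_realizer (subsets12 n) (inclusion_on (subsets12 n)) \<L>"
    "\<forall>x\<in>subsets12 n. finite {L\<in>\<L>. x \<in> Field L} \<and> card {L\<in>\<L>. x \<in> Field L} \<le> 2 * r"
    using local_realizer_exists[OF rM] by blast
  note att = ldim_P12_attained[OF this]
  define k where "k = ldim_P12 n"
  have k_le: "real k \<le> u + log 2 u + 7"
    using att(1) r by (simp add: k_def)
  obtain \<L>' where R: "local_realizer (subsets12 n) (inclusion_on (subsets12 n)) \<L>'"
    and mult: "\<forall>x\<in>subsets12 n. finite {L\<in>\<L>'. x \<in> Field L} \<and> card {L\<in>\<L>'. x \<in> Field L} \<le> k"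
    using att(2) unfolding k_def by blast
  \<comment> \<open>Some list must compare the incomparable \<open>{1}\<close> and
    \<open>{2}\<close>; positivity makes \<open>log 2 k\<close> meaningful.\<close>
  have k: "0 < k"
  proof -
    have in12: "{1} \<in> subsets12 n" "{2} \<in> subsets12 n"
      using n by (auto intro!: singleton_in_subsets12)
    moreover have "({1}, {2}) \<notin> inclusion_on (subsets12 n)" "({2}, {1}) \<notin> inclusion_on (subsets12 n)"
      by (simp_all add: inclusion_on_def)
    ultimately obtain L where L: "L \<in> \<L>'" "({1}, {2}) \<in> L"
      using R unfolding local_realizer_def by blast
    define F where "F = {L\<in>\<L>'. {1} \<in> Field L}"
    have "L \<in> F" "finite F" "card F \<le> k"
      using L in_Field[OF L(2)] mult in12(1) by (simp_all add: F_def)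
    then show ?thesis
      by (cases "k = 0") auto
  qed
  have "u \<le> k + log 2 k + 3"
    unfolding u_def
  proof (rule lower_bound_estimate[OF k refl n])
    show "n < (2 ^ 2 ^ k + 1) * (8 * k * (2 ^ 2 ^ k + 1) ^ 3) ^ k"
      by (rule local_realizer_lower_bound[OF R _ k refl]) (use mult in blast)
  qed
  moreover have "log 2 (real k) \<le> log 2 u + 4"
  proof -
    have "log 2 u \<le> 2 * u"
      using u by (intro log2_le_double) simp
    \<comment> \<open>In fact \<open>k \<le> 3 * u + 7\<close>; the generous 16 is a power of two
      and contributes exactly 4 to the logarithm.\<close>
    then have "real k \<le> 16 * u" using k_le u by simp
    then have "log 2 (real k) \<le> log 2 (16 * u)"
      using k u by (subst log_le_cancel_iff) auto
    also have "\<dots> = log 2 u + 4"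
      using u by (simp add: log_mult log2_two_power)
    finally show ?thesis .
  qed
  ultimately show ?thesis
    using k_le logu unfolding k_def by linarith
qed

theorem theorem9:
  shows "(\<lambda>n::nat. real (ldim_P12 n) - log 2 (log 2 (real n)))
           \<in> O[sequentially](\<lambda>n. log 2 (log 2 (log 2 (real n))))"
proof (rule bigoI)
  show "\<forall>\<^sub>F n in sequentially. norm (real (ldim_P12 n) - log 2 (log 2 (real n)))
      \<le> 8 * norm (log 2 (log 2 (log 2 (real n))))"
    using eventually_ge_at_top[of 16]
  proof eventually_elim
    case (elim n)
    then show ?case
      using ldim_P12_bound[of n] by simp
  qed
qed

end
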